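(* Let $p$ be a prime with $p\equiv 1\pmod 3$. Then for $M=(p-1)/3$ and also for $M=p-1$, $$\sum_{k=0}^{M}(-1)^k(6k+1)\frac{(\frac13)_k^3}{k!^3}\equiv p+\frac{p^3}{9}E_{p-3}\left(\tfrac13\right)\pmod{p^4}.$$
   Context: $(x)_k=x(x+1)\cdots(x+k-1)$ is the Pochhammer symbol, with $(x)_0=1$. The Euler polynomials $E_n(x)$ are defined by $\sum_{n\ge 0}E_n(x)\frac{t^n}{n!}=\frac{2e^{xt}}{e^t+1}$. A congruence modulo $p^4$ between rational numbers whose denominators are prime to $p$ means that the difference lies in $p^4\mathbb{Z}_p$, where $\mathbb{Z}_p$ is the ring of $p$-adic integers. *)

theory Defs
  imports
    "HOL-Computational_Algebra.Computational_Algebra"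
    "HOL-Number_Theory.Number_Theory"
begin

definition euler_gf :: "'a::field_char_0 \<Rightarrow> 'a fps" where
  "euler_gf x = 2 * fps_exp x / (fps_exp 1 + 1)"

text \<open>
  \<open>euler_poly n x\<close> is the value $E_n(x)$; the factor \<open>fact n\<close> undoes the $1/n!$ of the
  exponential generating function \<open>euler_gf x\<close>.
\<close>
definition euler_poly :: "nat \<Rightarrow> 'a::field_char_0 \<Rightarrow> 'a" where
  "euler_poly n x = fact n * fps_nth (euler_gf x) n"

text \<open>The division of power series is exact, because the denominator has constant term 2.\<close>
lemma euler_poly_gf:
  fixes x :: "'a::field_char_0"
  shows "Abs_fps (\<lambda>n. euler_poly n x / fact n) * (fps_exp 1 + 1) = 2 * fps_exp x"
proof -
  have "fps_nth (fps_exp 1 + 1 :: 'a fps) 0 \<noteq> 0"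
    by simp
  then have "euler_gf x * (fps_exp 1 + 1) = 2 * fps_exp x"
    unfolding euler_gf_def
    by (subst fps_divide_unit, assumption, subst mult.assoc, subst inverse_mult_eq_1, assumption) simp
  moreover have "Abs_fps (\<lambda>n. euler_poly n x / fact n) = euler_gf x"
    by (simp add: euler_poly_def fps_eq_iff)
  ultimately show ?thesis
    by simp
qed

text \<open>
  \<open>padic_integral_rats p\<close> is the ring of rational numbers that are $p$-adic integers, that is
  $\mathbb{Q} \cap \mathbb{Z}_p$: those whose reduced denominator is prime to $p$. A rational number
  lies in $p^m \mathbb{Z}_p$ iff it is $p^m$ times an element of this ring, so
  \<open>padic_cong p m r s\<close> says $r \equiv s \pmod{p^m}$.
\<close>
definition padic_integral_rats :: "nat \<Rightarrow> rat set" where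
  "padic_integral_rats p = {r. coprime (snd (quotient_of r)) (int p)}"

definition padic_cong :: "nat \<Rightarrow> nat \<Rightarrow> rat \<Rightarrow> rat \<Rightarrow> bool" where
  "padic_cong p m r s \<longleftrightarrow> (\<exists>z \<in> padic_integral_rats p. r - s = of_nat p ^ m * z)"

lemma padic_integral_rats_quotient:
  assumes "coprime b (int p)" and "b \<noteq> 0"
  shows "of_int a / of_int b \<in> padic_integral_rats p"
proof -
  obtain c d where cd: "quotient_of (of_int a / of_int b) = (c, d)"
    by (cases "quotient_of (of_int a / of_int b)")
  have d: "d > 0" and co: "coprime c d" and eq: "of_int a / of_int b = (of_int c / of_int d :: rat)"
    using quotient_of_denom_pos[OF cd] quotient_of_coprime[OF cd] quotient_of_div[OF cd]
    by simp_all
  from eq d assms(2) have "of_int (a * d) = (of_int (c * b) :: rat)"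
    by (simp add: field_simps)
  then have "a * d = c * b"
    by (simp only: of_int_eq_iff)
  then have "d dvd c * b"
    by (metis dvd_triv_right)
  with co have "d dvd b"
    by (simp add: coprime_commute coprime_dvd_mult_right_iff)
  with assms(1) show ?thesis
    by (auto simp: padic_integral_rats_def cd intro: coprime_divisors[OF _ dvd_refl])
qed

end

theory Submission
  imports Defs
begin

text \<open>
  Write $a = 1/3$, $n = (p-1)/3$ and $x_j = a + j$. Replacing two of the three factors $(a)_k/k!$ by
  $(a-x)_k/(1+x)_k$ and $(a+x)_k/(1-x)_k$ gives, after multiplication by
  $\prod_{i=1}^n (i^2-x^2)$, a polynomial of degree at most $n$ in $x^2$. At $x = x_j$ the sum
  terminates and is evaluated by the classical very-well-poised summation formula, so Lagrange
  interpolation at $x_0^2,\dots,x_n^2$ yields an exact expression for the sum up to $n$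
  (the value at $x = 0$) as a sum over $j \le n$. Since $x_n = p/3$, the term with $j = n$ is
  congruent to $p$ modulo $p^4$, while the one with $j < n$ is $p^3$ times something congruent to
  $\frac29 (-1)^j/(n-j)^2$ modulo $p$. The resulting alternating sum of inverse squares becomes
  $E_{p-3}(1/3)$ modulo $p$ by Fermat's little theorem and $E_m(x+1)+E_m(x)=2x^m$.
  For $n < k < p$ the summands are divisible by $p^3$, and the involution $k \mapsto n+p-k$ negates
  their quotients by $p^3$ modulo $p$.
\<close>

section \<open>A terminating well-poised sum\<close>

text \<open>Creative telescoping: \<open>d + n\<close> times the summand for \<open>Suc n\<close>,
  minus the summand for \<open>n\<close>, is a difference in \<open>k\<close>, and the right side is
  its partial sum in closed form. At \<open>m = Suc n\<close> the factor \<open>n choose m\<close>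
  makes that partial sum vanish.\<close>

lemma well_poised_telescope:
  fixes a c d :: "'a::field_char_0"
  assumes a: "\<And>k. pochhammer a k \<noteq> 0" and d: "\<And>k. k \<le> Suc n \<Longrightarrow> pochhammer d k \<noteq> 0"
    and c: "c = 1 + a - d" and m: "m \<le> Suc n"
  shows "(\<Sum>k\<le>m. (d + of_nat n) * (of_nat (Suc n choose k) * (a + 2 * of_nat k) * pochhammer a k
             * pochhammer c k / (pochhammer a (n + k + 2) * pochhammer d k))
           - of_nat (n choose k) * (a + 2 * of_nat k) * pochhammer a k
             * pochhammer c k / (pochhammer a (n + k + 1) * pochhammer d k))
         = - of_nat (n choose m) * pochhammer a (Suc m) * pochhammer c (Suc m)
             / (pochhammer a (n + m + 2) * pochhammer d m)"
  using m
proof (induction m)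
  case 0
  have nz: "pochhammer a (Suc n) \<noteq> 0" "a + of_nat (Suc n) \<noteq> 0"
    using a[of "n+1"] a[of "Suc (Suc n)"] by (auto simp: pochhammer_Suc)
  have e: "pochhammer a (Suc (Suc n)) = pochhammer a (Suc n) * (a + of_nat (Suc n))"
    by (rule pochhammer_Suc)
  show ?case
    using nz by (simp add: e c divide_simps del: pochhammer_Suc of_nat_Suc) (simp add: algebra_simps)
next
  case (Suc m)
  define A where "A = pochhammer a (Suc m)"
  define C where "C = pochhammer c (Suc m)"
  define D where "D = pochhammer d m"
  define B where "B = pochhammer a (n + m + 2)"
  define x y where "x = (of_nat (n choose m) :: 'a)" and "y = (of_nat (n choose Suc m) :: 'a)"
  define K where "K = (of_nat m :: 'a)"
  define N where "N = (of_nat n :: 'a)"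
  have B3: "pochhammer a (n + Suc m + 2) = B * (a + N + K + 2)"
    by (simp add: B_def N_def K_def pochhammer_Suc algebra_simps)
  have D1: "pochhammer d (Suc m) = D * (d + K)"
    by (simp add: D_def K_def pochhammer_Suc algebra_simps)
  have A1: "pochhammer a (Suc (Suc m)) = A * (a + K + 1)"
    unfolding A_def K_def by (subst pochhammer_Suc) (simp add: algebra_simps)
  have C1: "pochhammer c (Suc (Suc m)) = C * (c + K + 1)"
    unfolding C_def K_def by (subst pochhammer_Suc) (simp add: algebra_simps)
  have nz: "B \<noteq> 0" "a + N + K + 2 \<noteq> 0" "D \<noteq> 0" "d + K \<noteq> 0"
    using a[of "n+Suc m+2"] B3 d[of "Suc m"] D1 Suc.prems by auto
  have xy: "(N - K) * x = (K + 1) * y"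
  proof -
    have "(n - m) * (n choose m) = Suc m * (n choose Suc m)"
      by (metis binomial_absorb_comp binomial_absorption mult.commute)
    then have "of_nat ((n - m) * (n choose m)) = (of_nat (Suc m * (n choose Suc m)) :: 'a)"
      by simp
    then show ?thesis
      by (cases "m \<le> n") (auto simp: x_def y_def N_def K_def of_nat_diff algebra_simps)
  qed
  have bin: "of_nat (Suc n choose Suc m) = x + y"
    by (simp add: x_def y_def)
  \<comment> \<open>This is the induction step with the common factors removed. Since
    \<open>c = 1 + a - d\<close>, the two sides differ by \<open>c + K + 1\<close> times the
    difference of the two sides of \<open>xy\<close>.\<close>
  have key: "- x * (a + N + K + 2) * (d + K) + ((d + N) * (x + y) * (a + 2 * (K + 1))
      - y * (a + 2 * (K + 1)) * (a + N + K + 2))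
      = - y * (a + K + 1) * (c + K + 1)"
    (is "?l = ?r")
  proof -
    have "?l - ?r = (a + K + 2 - d) * ((N - K) * x - (K + 1) * y)"
      unfolding c by (simp add: algebra_simps)
    then have "?l - ?r = 0" using xy by (simp only: diff_self mult_zero_right)
    then show ?thesis by (simp only: right_minus_eq)
  qed
  have step: "- x * A * C / (B * D)
      + ((d + N) * ((x + y) * (a + 2 * (K + 1)) * A * C / (B * (a + N + K + 2) * (D * (d + K))))
         - y * (a + 2 * (K + 1)) * A * C / (B * (D * (d + K))))
      = - y * (A * (a + K + 1)) * (C * (c + K + 1)) / (B * (a + N + K + 2) * (D * (d + K)))"
    (is "?L1 + (?L2 - ?L3) = ?R")
  proof -
    let ?W = "A * C / (B * (a + N + K + 2) * (D * (d + K)))"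
    have 1: "?L1 = - x * (a + N + K + 2) * (d + K) * ?W"
      and 3: "?L3 = y * (a + 2 * (K + 1)) * (a + N + K + 2) * ?W"
      using nz by simp_all
    have 2: "?L2 = (d + N) * ((x + y) * (a + 2 * (K + 1)) * ?W)"
      by simp
    have ring: "r * W + (e * (q * f * W) - s * W) = (r + (e * q * f - s)) * W" for r e q f s W :: 'a
      by (simp add: algebra_simps)
    have "?L1 + (?L2 - ?L3) = (- x * (a + N + K + 2) * (d + K)
        + ((d + N) * (x + y) * (a + 2 * (K + 1)) - y * (a + 2 * (K + 1)) * (a + N + K + 2))) * ?W"
      unfolding 1 2 3 by (rule ring)
    also have "\<dots> = ?R" unfolding key by (simp only: times_divide_eq_right mult_ac)
    finally show ?thesis .
  qed
  have "Suc m \<le> Suc n" "m \<le> Suc n" using Suc.prems by auto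
  note IH = Suc.IH[OF this(2)]
  have B2: "pochhammer a (n + Suc m + 1) = B" by (simp add: B_def)
  show ?case
    unfolding sum.atMost_Suc IH B3 D1 A1 C1 bin B2
    using step
    unfolding A_def[symmetric] C_def[symmetric] D_def[symmetric] B_def[symmetric]
      x_def[symmetric] y_def[symmetric] N_def[symmetric] K_def[symmetric]
    by (simp add: K_def N_def add_ac)
qed

text \<open>The terminating very-well-poised 4F3 summation at argument -1. Writing
  \<open>S n\<close> for the sum, the telescoped relation reads
  \<open>(d + n) * S (n + 1) = S n\<close>, and \<open>S 0 = 1\<close>.\<close>

lemma well_poised_sum:
  fixes a c d :: "'a::field_char_0"
  assumes a: "\<And>k. pochhammer a k \<noteq> 0" and d: "\<And>k. k \<le> n \<Longrightarrow> pochhammer d k \<noteq> 0"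
    and c: "c = 1 + a - d"
  shows "(\<Sum>k\<le>n. of_nat (n choose k) * (a + 2 * of_nat k) * pochhammer a k
             * pochhammer c k / (pochhammer a (n + k + 1) * pochhammer d k))
         = 1 / pochhammer d n"
  using d
proof (induction n)
  case 0
  show ?case using a[of 1] by simp
next
  case (Suc n)
  let ?T = "\<lambda>n k. of_nat (n choose k) * (a + 2 * of_nat k) * pochhammer a k
             * pochhammer c k / (pochhammer a (n + k + 1) * pochhammer d k)"
  \<comment> \<open>Both sums may run up to \<open>Suc n\<close>, because
    \<open>n choose Suc n = 0\<close>.\<close>
  have "(d + of_nat n) * (\<Sum>k\<le>Suc n. ?T (Suc n) k) - (\<Sum>k\<le>Suc n. ?T n k)
     = (\<Sum>k\<le>Suc n. (d + of_nat n) * ?T (Suc n) k - ?T n k)"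
    by (simp only: sum_subtractf sum_distrib_left)
  also have "\<dots> = 0"
    using well_poised_telescope[OF a Suc.prems c order_refl] by simp
  finally have "(d + of_nat n) * (\<Sum>k\<le>Suc n. ?T (Suc n) k) = (\<Sum>k\<le>n. ?T n k)"
    by simp
  also have "\<dots> = 1 / pochhammer d n" using Suc by simp
  finally have *: "(d + of_nat n) * (\<Sum>k\<le>Suc n. ?T (Suc n) k) = 1 / pochhammer d n" .
  have "pochhammer d (Suc n) = pochhammer d n * (d + of_nat n)"
    by (rule pochhammer_Suc)
  with Suc.prems[of "Suc n"] have nz: "d + of_nat n \<noteq> 0"
    and eq: "1 / pochhammer d (Suc n) = 1 / pochhammer d n / (d + of_nat n)" by auto
  have "S = r / e" if "e * S = r" "e \<noteq> 0" for S r e :: 'a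
    using that by auto
  from this[OF * nz] show ?case by (simp only: eq)
qed

section \<open>Lagrange interpolation\<close>

lemma lagrange_interpolation:
  fixes P :: "'a::field poly" and X :: "nat \<Rightarrow> 'a"
  assumes deg: "degree P \<le> n" and inj: "inj_on X {..n}"
  shows "poly P y = (\<Sum>j\<le>n. poly P (X j) * (\<Prod>l\<in>{..n}-{j}. (y - X l) / (X j - X l)))"
proof -
  define L where "L j = (\<Prod>l\<in>{..n}-{j}. Polynomial.smult (1 / (X j - X l)) [:- X l, 1:])" for j
  define Q where "Q = (\<Sum>j\<le>n. Polynomial.smult (poly P (X j)) (L j))"
  have polyL: "poly (L j) z = (\<Prod>l\<in>{..n}-{j}. (z - X l) / (X j - X l))" for j z
    by (simp add: L_def poly_prod diff_divide_distrib)
  have degL: "degree (L j) \<le> n" if "j \<le> n" for j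
  proof -
    have "degree (L j) \<le> (\<Sum>l\<in>{..n}-{j}. degree (Polynomial.smult (1 / (X j - X l)) [:- X l, 1:]))"
      unfolding L_def by (rule degree_prod_sum_le[unfolded o_def]) simp
    also have "\<dots> \<le> (\<Sum>l\<in>{..n}-{j}. 1)"
      by (intro sum_mono) (auto intro: order.trans[OF degree_smult_le])
    also have "\<dots> = n" using that by simp
    finally show ?thesis .
  qed
  \<comment> \<open>Both polynomials have degree at most \<open>n\<close> and agree at the
    \<open>n + 1\<close> distinct nodes.\<close>
  have "P = Q"
  proof (rule poly_eqI_degree[where A = "X ` {..n}"])
    fix x assume "x \<in> X ` {..n}"
    then obtain i where i: "i \<le> n" "x = X i" by auto
    have "poly (L j) (X i) = (if i = j then 1 else 0)" if "j \<le> n" for j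
    proof (cases "i = j")
      case True
      then show ?thesis unfolding polyL
        using inj that by (auto intro!: prod.neutral simp: inj_on_def split: if_splits)
    next
      case False
      then show ?thesis unfolding polyL
        using i by (auto intro!: prod_zero)
    qed
    then have "poly Q (X i) = (\<Sum>j\<le>n. if i = j then poly P (X j) else 0)"
      unfolding Q_def poly_sum poly_smult by (intro sum.cong) auto
    then show "poly P x = poly Q x" using i by simp
  next
    show "card (X ` {..n}) > degree P" using deg by (simp add: card_image[OF inj])
    have "degree Q \<le> n"
      unfolding Q_def by (intro degree_sum_le) (auto intro: order.trans[OF degree_smult_le] degL)
    then show "card (X ` {..n}) > degree Q" by (simp add: card_image[OF inj])
  qed
  then have "poly P y = poly Q y" by simp
  then show ?thesis unfolding Q_def poly_sum poly_smult polyL .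
qed

text \<open>The \<open>j\<close> negative factors give \<open>(- 1) ^ j * fact j\<close>, the
  positive ones \<open>fact (n - j)\<close>. This evaluates the interpolation weights and, later,
  Pochhammer symbols modulo \<open>p\<close> with their factor divisible by \<open>p\<close>
  removed.\<close>

lemma prod_of_nat_diff_remove:
  fixes j n :: nat
  assumes "j \<le> n"
  shows "(\<Prod>l\<in>{..n}-{j}. of_nat l - of_nat j :: 'a::field_char_0)
           = (- 1) ^ j * fact j * fact (n - j)"
proof -
  have *: "{..n}-{j} = {..<j} \<union> {j<..n}" using assms by auto
  have "(\<Prod>l\<in>{..<j}. of_nat l - of_nat j :: 'a) = (\<Prod>l\<in>{..<j}. - 1 * of_nat (j - l))"
    by (intro prod.cong) (auto simp: of_nat_diff)
  also have "\<dots> = (- 1) ^ j * (\<Prod>l\<in>{..<j}. of_nat (j - l))"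
    by (subst prod.distrib) simp
  also have "(\<Prod>l\<in>{..<j}. of_nat (j - l) :: 'a) = fact j"
  proof -
    have "(\<Prod>l<j. j - l) = \<Prod>{1..j}"
      by (rule prod.reindex_bij_witness[of _ "\<lambda>i. j - i" "\<lambda>i. j - i"]) auto
    then show ?thesis unfolding fact_prod of_nat_prod[symmetric] by simp
  qed
  finally have 1: "(\<Prod>l\<in>{..<j}. of_nat l - of_nat j :: 'a) = (- 1) ^ j * fact j" .
  have "(\<Prod>l\<in>{j<..n}. of_nat l - of_nat j :: 'a) = (\<Prod>l\<in>{j<..n}. of_nat (l - j))"
    by (intro prod.cong) (auto simp: of_nat_diff)
  also have "\<dots> = fact (n - j)"
  proof -
    have "(\<Prod>l\<in>{j<..n}. l - j) = \<Prod>{1..n - j}"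
      by (rule prod.reindex_bij_witness[of _ "\<lambda>i. i + j" "\<lambda>i. i - j"]) auto
    then show ?thesis unfolding fact_prod of_nat_prod[symmetric] by simp
  qed
  finally show ?thesis
    unfolding * by (subst prod.union_disjoint) (auto simp: 1)
qed

section \<open>Expansion by interpolation\<close>

lemma pochhammer_lessThan: "pochhammer a k = (\<Prod>i<k. a + of_nat i)"
  by (simp add: pochhammer_prod atLeast0LessThan)

lemma pochhammer_Suc_shift: "pochhammer (1 + a) k = (\<Prod>i\<in>{1..k}. of_nat i + a)"
proof -
  have "(\<Prod>i<k. 1 + a + of_nat i) = (\<Prod>i\<in>{1..k}. of_nat i + a)"
    by (rule prod.reindex_bij_witness[of _ "\<lambda>i. i - 1" "\<lambda>i. Suc i"]) (auto simp: add_ac of_nat_diff)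
  then show ?thesis by (simp add: pochhammer_lessThan)
qed

lemma prod_diff_squares_shift:
  fixes x :: "'a::comm_ring_1"
  shows "(\<Prod>i\<in>{1..k}. of_nat i ^ 2 - x ^ 2) = pochhammer (1 - x) k * pochhammer (1 + x) k"
  using pochhammer_Suc_shift[of "- x" k] pochhammer_Suc_shift[of x k]
  by (simp add: prod.distrib[symmetric] power2_eq_square algebra_simps)

lemma pochhammer_minus_of_nat:
  "pochhammer (- of_nat j :: 'a::field_char_0) k = (- 1) ^ k * (fact k * of_nat (j choose k))"
  by (simp add: binomial_gbinomial gbinomial_pochhammer mult.assoc[symmetric] power_mult_distrib[symmetric])

lemma pochhammer_nonzero_of_notin_Ints:
  fixes a :: "'a::field_char_0"
  assumes "a \<notin> \<int>"
  shows "pochhammer a k \<noteq> 0"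
  using assms by (auto simp: pochhammer_eq_0_iff)

text \<open>Interpolation at the squares of \<open>a, a + 1, ..., a + n\<close>, evaluated at 0. The
  hypothesis makes the squares distinct, because \<open>x i + x j = 2 * a + i + j\<close> is
  nonzero, and keeps the Pochhammer denominators away from 0.\<close>

lemma well_poised_expansion:
  fixes a :: "'a::field_char_0"
  assumes a: "2 * a \<notin> \<int>"
  shows "(\<Sum>k\<le>n. (- 1) ^ k * (a + 2 * of_nat k) * pochhammer a k ^ 3 / fact k ^ 3)
    = (\<Sum>j\<le>n. 2 * pochhammer a (Suc n) ^ 2 * pochhammer (1 + a + of_nat j) n
        * pochhammer (1 - a - of_nat j) n
        / (fact n ^ 2 * fact j * fact (n - j) * pochhammer (2 * a + of_nat j) (Suc n)))"
    (is "?S = sum ?W _")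
proof -
  define x where "x j = a + of_nat j" for j
  define c where "c k = (- 1) ^ k * (a + 2 * of_nat k) * pochhammer a k / fact k" for k
  \<comment> \<open>In the variable \<open>y = x^2\<close>, the first product is
    \<open>(a - x)_k (a + x)_k\<close>; the second is what remains of the product of all
    \<open>i^2 - y\<close> with \<open>1 \<le> i \<le> n\<close> after division by
    \<open>(1 - x)_k (1 + x)_k\<close>.\<close>
  define P where "P = (\<Sum>k\<le>n. Polynomial.smult (c k)
     ((\<Prod>i<k. [:x i ^ 2, - 1:]) * (\<Prod>i\<in>{k<..n}. [:of_nat i ^ 2, - 1:])))"
  have aZ: "a \<notin> \<int>" using a by (metis Ints_mult Ints_numeral)
  have poly_P: "poly P y = (\<Sum>k\<le>n. c k * ((\<Prod>i<k. x i ^ 2 - y) * (\<Prod>i\<in>{k<..n}. of_nat i ^ 2 - y)))"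
    for y by (simp add: P_def poly_sum poly_prod)
  have deg: "degree P \<le> n"
  proof -
    have "degree ((\<Prod>i<k. [:x i ^ 2, - 1:]) * (\<Prod>i\<in>{k<..n}. [:of_nat i ^ 2, - 1:])) \<le> n"
      if "k \<le> n" for k
    proof -
      have "degree (\<Prod>i<k. [:x i ^ 2, - 1:]) \<le> (\<Sum>i<k. degree [:x i ^ 2, - 1:])"
        by (rule degree_prod_sum_le[unfolded o_def]) simp
      moreover have "degree (\<Prod>i\<in>{k<..n}. [:of_nat i ^ 2, - 1 :: 'a:])
          \<le> (\<Sum>i\<in>{k<..n}. degree [:of_nat i ^ 2, - 1 :: 'a:])"
        by (rule degree_prod_sum_le[unfolded o_def]) simp
      ultimately show ?thesis
        using that by (intro order.trans[OF degree_mult_le]) simp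
    qed
    then show ?thesis
      unfolding P_def by (intro degree_sum_le) (auto intro: order.trans[OF degree_smult_le])
  qed
  have xZ: "x j \<notin> \<int>" for j
    using aZ Ints_diff[of "x j" "of_nat j"] by (auto simp: x_def)
  have xx: "x l + x j \<noteq> 0" for l j
  proof
    assume "x l + x j = 0"
    then have "2 * a = - of_nat (l + j)" by (simp add: x_def algebra_simps eq_neg_iff_add_eq_0)
    then show False using a by (metis Ints_minus Ints_of_nat)
  qed
  have inj: "inj_on (\<lambda>j. x j ^ 2) {..n}"
  proof (rule inj_onI)
    fix i j assume "x i ^ 2 = x j ^ 2"
    then have "x i = x j" using xx[of i j] by (auto simp: power2_eq_iff)
    then show "i = j" by (simp add: x_def)
  qed
  have P0: "poly P 0 = fact n ^ 2 * ?S"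
  proof -
    have "c k * ((\<Prod>i<k. x i ^ 2) * (\<Prod>i\<in>{k<..n}. of_nat i ^ 2))
        = fact n ^ 2 * ((- 1) ^ k * (a + 2 * of_nat k) * pochhammer a k ^ 3 / fact k ^ 3)"
      if "k \<le> n" for k
    proof -
      have 1: "(\<Prod>i<k. x i ^ 2) = pochhammer a k ^ 2"
        by (simp add: pochhammer_lessThan x_def prod_power_distrib)
      have "{1..n} = {1..k} \<union> {k<..n}" using that by auto
      then have "(fact n :: 'a) = fact k * (\<Prod>i\<in>{k<..n}. of_nat i)"
        unfolding fact_prod of_nat_prod by (simp only:) (rule prod.union_disjoint, auto)
      then have 2: "(fact n :: 'a) ^ 2 = fact k ^ 2 * (\<Prod>i\<in>{k<..n}. of_nat i ^ 2)"
        by (simp add: power_mult_distrib prod_power_distrib)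
      show ?thesis unfolding 1 2 c_def by (simp add: power2_eq_square power3_eq_cube)
    qed
    then show ?thesis unfolding poly_P sum_distrib_left by (intro sum.cong) auto
  qed
  \<comment> \<open>For \<open>k > j\<close> the factor with \<open>i = j\<close> vanishes; the rest
    is \<open>well_poised_sum\<close> of length \<open>j\<close> with \<open>d = 1 - a - j\<close>
    and \<open>c = 2 * a + j\<close>.\<close>
  have PX: "poly P (x j ^ 2) = (- 1) ^ j * x j * (pochhammer (1 - x j) n * pochhammer (1 + x j) n)"
    (is "_ = _ * ?R") if j: "j \<le> n" for j
  proof -
    define d where "d = 1 - a - of_nat j"
    \<comment> \<open>Pulling out \<open>A\<close> leaves \<open>pochhammer (1 + x j) k\<close> from
      \<open>pochhammer a (j + k + 1)\<close>, which matches a factor of \<open>?R\<close>.\<close>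
    define A where "A = pochhammer a (Suc j)"
    have A: "A \<noteq> 0" unfolding A_def by (rule pochhammer_nonzero_of_notin_Ints[OF aZ])
    have d: "d = 1 - x j" by (simp add: d_def x_def)
    have dZ: "d \<notin> \<int>" and eZ: "1 + x j \<notin> \<int>"
      using xZ[of j] Ints_diff[of 1 d] Ints_diff[of "1 + x j" 1] unfolding d by auto
    have nzd: "pochhammer d k \<noteq> 0" and nze: "pochhammer (1 + x j) k \<noteq> 0" for k
      by (intro pochhammer_nonzero_of_notin_Ints dZ eZ)+
    let ?T = "\<lambda>k. of_nat (j choose k) * (a + 2 * of_nat k) * pochhammer a k
             * pochhammer (2 * a + of_nat j) k / (pochhammer a (j + k + 1) * pochhammer d k)"
    have "poly P (x j ^ 2) = (\<Sum>k\<le>n. if k \<le> j then ?R * (A * ?T k) else 0)"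
      unfolding poly_P
    proof (intro sum.cong refl)
      fix k assume "k \<in> {..n}"
      then have k: "k \<le> n" by simp
      show "c k * ((\<Prod>i<k. x i ^ 2 - x j ^ 2) * (\<Prod>i\<in>{k<..n}. of_nat i ^ 2 - x j ^ 2))
        = (if k \<le> j then ?R * (A * ?T k) else 0)"
      proof (cases "k \<le> j")
        case False
        then have "(\<Prod>i<k. x i ^ 2 - x j ^ 2) = 0" by (intro prod_zero) auto
        then show ?thesis using False by simp
      next
        case True
        have "(\<Prod>i<k. x i ^ 2 - x j ^ 2) = (\<Prod>i<k. (- of_nat j + of_nat i) * (2 * a + of_nat j + of_nat i))"
          by (intro prod.cong) (auto simp: x_def power2_eq_square algebra_simps)
        also have "\<dots> = (- 1) ^ k * (fact k * of_nat (j choose k)) * pochhammer (2 * a + of_nat j) k"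
          by (simp only: prod.distrib pochhammer_lessThan[symmetric] pochhammer_minus_of_nat)
        finally have 1: "(\<Prod>i<k. x i ^ 2 - x j ^ 2)
          = (- 1) ^ k * (fact k * of_nat (j choose k)) * pochhammer (2 * a + of_nat j) k" .
        have "{1..n} = {1..k} \<union> {k<..n}" using k by auto
        then have "(\<Prod>i\<in>{1..n}. of_nat i ^ 2 - x j ^ 2)
            = (\<Prod>i\<in>{1..k}. of_nat i ^ 2 - x j ^ 2) * (\<Prod>i\<in>{k<..n}. of_nat i ^ 2 - x j ^ 2)"
          by (simp only:) (rule prod.union_disjoint, auto)
        then have 2: "?R = pochhammer d k * pochhammer (1 + x j) k
            * (\<Prod>i\<in>{k<..n}. of_nat i ^ 2 - x j ^ 2)"
          by (simp only: prod_diff_squares_shift d)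
        have 3: "pochhammer a (j + k + 1) = A * pochhammer (1 + x j) k"
          using pochhammer_product'[of a "Suc j" k] by (simp add: A_def x_def add_ac)
        have 4: "(- 1) ^ k * ((- 1) ^ k * z) = z" for z :: 'a
          by (simp add: mult.assoc[symmetric] power_mult_distrib[symmetric])
        show ?thesis
          unfolding 1 2 3 c_def using True A nzd[of k] nze[of k] by (simp add: 4 mult_ac)
      qed
    qed
    also have "\<dots> = (\<Sum>k\<le>j. ?R * (A * ?T k))"
      using j by (intro sum.mono_neutral_cong_right) auto
    also have "\<dots> = ?R * (A * (\<Sum>k\<le>j. ?T k))"
      by (simp only: sum_distrib_left)
    also have "(\<Sum>k\<le>j. ?T k) = 1 / pochhammer d j"
      by (rule well_poised_sum[OF pochhammer_nonzero_of_notin_Ints[OF aZ] nzd]) (simp add: d_def)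
    \<comment> \<open>Read backwards, the factors of \<open>pochhammer d j\<close> are those of
      \<open>pochhammer a j\<close> negated, so only the last factor \<open>x j\<close> of
      \<open>A\<close> survives, up to sign.\<close>
    also have "pochhammer d j = (- 1) ^ j * pochhammer a j"
      using pochhammer_minus[of "a + of_nat j - 1" j] by (simp add: d_def algebra_simps)
    also have "A * (1 / ((- 1) ^ j * pochhammer a j)) = (- 1) ^ j * x j"
      using pochhammer_nonzero_of_notin_Ints[OF aZ, of j]
      by (cases "even j") (simp_all add: A_def x_def pochhammer_Suc)
    finally show ?thesis by (simp only: mult.commute)
  qed
  \<comment> \<open>The sign in the interpolation weight cancels the one in \<open>PX\<close>. The
    omitted factors \<open>x j\<close> and \<open>2 * x j\<close> complete the products to
    \<open>pochhammer a (Suc n)\<close> and \<open>pochhammer (2 * a + j) (Suc n)\<close>.\<close>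
  have "fact n ^ 2 * ?S = (\<Sum>j\<le>n. fact n ^ 2 * ?W j)"
    unfolding P0[symmetric] lagrange_interpolation[OF deg inj, of 0]
  proof (intro sum.cong refl)
    fix j assume "j \<in> {..n}"
    then have j: "j \<le> n" by simp
    have ins: "insert j ({..n} - {j}) = {..n}" using j by auto
    have x0: "x j \<noteq> 0" using xZ[of j] by auto
    have "pochhammer a (Suc n) = (\<Prod>l\<in>insert j ({..n} - {j}). x l)"
      unfolding ins by (simp add: pochhammer_lessThan x_def lessThan_Suc_atMost)
    then have 1: "pochhammer a (Suc n) = x j * (\<Prod>l\<in>{..n} - {j}. x l)"
      by (subst (asm) prod.insert) simp_all
    have "pochhammer (2 * a + of_nat j) (Suc n) = (\<Prod>l\<in>insert j ({..n} - {j}). x l + x j)"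
      unfolding ins
      by (simp add: pochhammer_lessThan x_def lessThan_Suc_atMost algebra_simps del: prod.lessThan_Suc)
    then have 2: "pochhammer (2 * a + of_nat j) (Suc n) = 2 * x j * (\<Prod>l\<in>{..n} - {j}. x l + x j)"
      by (subst (asm) prod.insert) simp_all
    have nz2: "(\<Prod>l\<in>{..n} - {j}. x l + x j) \<noteq> 0" using xx by simp
    have "(\<Prod>l\<in>{..n} - {j}. (0 - x l ^ 2) / (x j ^ 2 - x l ^ 2))
       = (\<Prod>l\<in>{..n} - {j}. x l ^ 2 / ((of_nat l - of_nat j) * (x l + x j)))"
    proof (intro prod.cong refl)
      fix l
      have "(0 - x l ^ 2) / (x j ^ 2 - x l ^ 2) = x l ^ 2 / (x l ^ 2 - x j ^ 2)"
        by (metis diff_0 minus_diff_eq minus_divide_divide)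
      also have "x l ^ 2 - x j ^ 2 = (of_nat l - of_nat j) * (x l + x j)"
        by (simp add: x_def power2_eq_square algebra_simps)
      finally show "(0 - x l ^ 2) / (x j ^ 2 - x l ^ 2)
          = x l ^ 2 / ((of_nat l - of_nat j) * (x l + x j))" .
    qed
    also have "\<dots> = (\<Prod>l\<in>{..n} - {j}. x l) ^ 2
        / (((- 1) ^ j * fact j * fact (n - j)) * (\<Prod>l\<in>{..n} - {j}. x l + x j))"
      by (simp only: prod_dividef prod.distrib prod_of_nat_diff_remove[OF j] prod_power_distrib)
    finally have 3: "(\<Prod>l\<in>{..n} - {j}. (0 - x l ^ 2) / (x j ^ 2 - x l ^ 2))
      = (\<Prod>l\<in>{..n} - {j}. x l) ^ 2
        / (((- 1) ^ j * fact j * fact (n - j)) * (\<Prod>l\<in>{..n} - {j}. x l + x j))" .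
    have 4: "1 + a + of_nat j = 1 + x j" "1 - a - of_nat j = 1 - x j"
      by (simp_all add: x_def)
    show "poly P (x j ^ 2) * (\<Prod>l\<in>{..n} - {j}. (0 - x l ^ 2) / (x j ^ 2 - x l ^ 2))
      = fact n ^ 2 * ?W j"
      unfolding PX[OF j] 1 2 3 4 using x0 nz2
      by (simp add: power2_eq_square mult_ac)
  qed
  then show ?thesis unfolding sum_distrib_left[symmetric] by simp
qed

section \<open>Rational numbers integral at a prime\<close>

locale prime_localization =
  fixes p :: nat
  assumes prime_p: "prime p"
begin

abbreviation Zp :: "rat set" where "Zp \<equiv> padic_integral_rats p"

text \<open>The units of the integers localized at \<open>p\<close>. The condition
  \<open>u \<noteq> 0\<close> matters because \<open>1 / 0 = 0\<close> is integral.\<close>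

definition punit :: "rat \<Rightarrow> bool" where
  "punit u \<longleftrightarrow> u \<noteq> 0 \<and> u \<in> Zp \<and> 1 / u \<in> Zp"

text \<open>
  In contrast to \<open>padic_cong\<close>, both sides are required to be integral, which makes the relation
  compatible with multiplication.
\<close>
definition pcong :: "nat \<Rightarrow> rat \<Rightarrow> rat \<Rightarrow> bool" where
  "pcong m x y \<longleftrightarrow> x \<in> Zp \<and> y \<in> Zp \<and> padic_cong p m x y"

text \<open>Without the demand that fractions be reduced, closure under sums and products becomes a
  computation with numerators and denominators.\<close>

lemma Zp_iff: "r \<in> Zp \<longleftrightarrow> (\<exists>a b. \<not> int p dvd b \<and> r = of_int a / of_int b)"
proof
  assume r: "r \<in> Zp"
  obtain c d where cd: "quotient_of r = (c, d)" by (cases "quotient_of r")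
  from r cd have "coprime d (int p)" by (simp add: padic_integral_rats_def)
  then have "\<not> int p dvd d"
    using prime_p by (metis coprime_common_divisor dvd_refl not_prime_unit prime_nat_int_transfer)
  with quotient_of_div[OF cd] show "\<exists>a b. \<not> int p dvd b \<and> r = of_int a / of_int b" by blast
next
  assume "\<exists>a b. \<not> int p dvd b \<and> r = of_int a / of_int b"
  then obtain a b where ab: "\<not> int p dvd b" "r = of_int a / of_int b" by blast
  then have "coprime b (int p)"
    using prime_p by (metis coprime_commute prime_imp_coprime prime_nat_int_transfer)
  moreover have "b \<noteq> 0" using ab by auto
  ultimately show "r \<in> Zp" using padic_integral_rats_quotient ab by simp
qed

lemma Zp_of_int [simp]: "of_int a \<in> Zp"
  unfolding Zp_iff using prime_p
  by (intro exI[of _ a] exI[of _ 1]) (auto simp: prime_nat_iff)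

lemma Zp_of_nat [simp]: "of_nat a \<in> Zp"
  using Zp_of_int[of "int a"] by simp

lemma Zp_0 [simp]: "0 \<in> Zp" and Zp_1 [simp]: "1 \<in> Zp" and Zp_numeral [simp]: "numeral k \<in> Zp"
  using Zp_of_int[of 0] Zp_of_int[of 1] Zp_of_int[of "numeral k"] by simp_all

lemma Zp_add [intro]: assumes "x \<in> Zp" "y \<in> Zp" shows "x + y \<in> Zp"
proof -
  from assms obtain a b c d where *: "\<not> int p dvd b" "x = of_int a / of_int b"
    "\<not> int p dvd d" "y = of_int c / of_int d" unfolding Zp_iff by blast
  then have nz: "b \<noteq> 0" "d \<noteq> 0" by auto
  then have "x + y = of_int (a * d + c * b) / of_int (b * d)"
    unfolding * by (simp add: field_simps)
  moreover have "\<not> int p dvd b * d"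
    using * prime_p by (simp add: prime_dvd_mult_iff)
  ultimately show ?thesis unfolding Zp_iff by blast
qed

lemma Zp_mult [intro]: assumes "x \<in> Zp" "y \<in> Zp" shows "x * y \<in> Zp"
proof -
  from assms obtain a b c d where *: "\<not> int p dvd b" "x = of_int a / of_int b"
    "\<not> int p dvd d" "y = of_int c / of_int d" unfolding Zp_iff by blast
  then have "x * y = of_int (a * c) / of_int (b * d)" by simp
  moreover have "\<not> int p dvd b * d"
    using * prime_p by (simp add: prime_dvd_mult_iff)
  ultimately show ?thesis unfolding Zp_iff by blast
qed

lemma Zp_minus [intro]: "x \<in> Zp \<Longrightarrow> - x \<in> Zp"
  using Zp_mult[of "- 1" x] Zp_of_int[of "- 1"] by simp

lemma Zp_diff [intro]: "x \<in> Zp \<Longrightarrow> y \<in> Zp \<Longrightarrow> x - y \<in> Zp"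
  using Zp_add[of x "- y"] by auto

lemma Zp_power [intro]: "x \<in> Zp \<Longrightarrow> x ^ k \<in> Zp"
  by (induction k) auto

lemma Zp_sum [intro]: "(\<And>i. i \<in> A \<Longrightarrow> f i \<in> Zp) \<Longrightarrow> sum f A \<in> Zp"
  by (induction A rule: infinite_finite_induct) auto

lemma Zp_divide_punit [intro]: "x \<in> Zp \<Longrightarrow> punit u \<Longrightarrow> x / u \<in> Zp"
  using Zp_mult[of x "1 / u"] by (auto simp: punit_def)

section \<open>Units at \<open>p\<close>\<close>

lemma punit_Zp: "punit u \<Longrightarrow> u \<in> Zp" and punit_nonzero: "punit u \<Longrightarrow> u \<noteq> 0"
  by (auto simp: punit_def)

lemma punit_quotient:
  assumes "\<not> int p dvd a" "\<not> int p dvd b"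
  shows "punit (of_int a / of_int b)"
proof -
  have "a \<noteq> 0" "b \<noteq> 0" using assms by auto
  moreover have "of_int a / of_int b \<in> Zp" "of_int b / of_int a \<in> Zp"
    unfolding Zp_iff using assms by blast+
  ultimately show ?thesis by (simp add: punit_def)
qed

lemma punit_of_nat: assumes "0 < k" "k < p" shows "punit (of_nat k)"
proof -
  have "\<not> int p dvd int k" using assms by (simp add: nat_dvd_not_less)
  from punit_quotient[OF this, of 1] show ?thesis using prime_p by (simp add: prime_nat_iff)
qed

lemma punit_mult [intro]: "punit u \<Longrightarrow> punit v \<Longrightarrow> punit (u * v)"
  using Zp_mult[of "1 / u" "1 / v"] by (auto simp: punit_def)

lemma punit_1 [simp]: "punit 1"
  by (simp add: punit_def)

lemma punit_minus [intro]: "punit u \<Longrightarrow> punit (- u)"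
  using Zp_minus[of "1 / u"] by (auto simp: punit_def)

lemma punit_power [intro]: "punit u \<Longrightarrow> punit (u ^ k)"
  by (induction k) auto

lemma punit_prod [intro]: "(\<And>i. i \<in> A \<Longrightarrow> punit (f i)) \<Longrightarrow> punit (prod f A)"
  by (induction A rule: infinite_finite_induct) auto

lemma punit_fact: "k < p \<Longrightarrow> punit (fact k)"
  unfolding fact_prod of_nat_prod by (intro punit_prod punit_of_nat) auto

section \<open>Congruences between integral rationals\<close>

lemma pcongI: "y \<in> Zp \<Longrightarrow> z \<in> Zp \<Longrightarrow> x = y + of_nat p ^ m * z \<Longrightarrow> pcong m x y"
  unfolding pcong_def padic_cong_def by (auto intro!: Zp_add Zp_mult Zp_power)

lemma pcongE:
  assumes "pcong m x y"
  obtains z where "x \<in> Zp" "y \<in> Zp" "z \<in> Zp" "x = y + of_nat p ^ m * z"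
  using assms unfolding pcong_def padic_cong_def by (auto simp: algebra_simps)

lemma pcong_refl [simp]: "x \<in> Zp \<Longrightarrow> pcong m x x"
  by (rule pcongI[of _ 0]) auto

lemma pcong_sym: assumes "pcong m x y" shows "pcong m y x"
proof -
  obtain z where "x \<in> Zp" "y \<in> Zp" "z \<in> Zp" "x = y + of_nat p ^ m * z"
    using pcongE[OF assms] .
  then show ?thesis by (intro pcongI[of _ "- z"]) auto
qed

lemma pcong_trans [trans]:
  assumes "pcong m x y" "pcong m y w" shows "pcong m x w"
proof -
  obtain z where "y \<in> Zp" "z \<in> Zp" "x = y + of_nat p ^ m * z"
    using pcongE[OF assms(1)] .
  moreover obtain z' where "w \<in> Zp" "z' \<in> Zp" "y = w + of_nat p ^ m * z'"
    using pcongE[OF assms(2)] .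
  ultimately show ?thesis by (intro pcongI[of _ "z + z'"]) (auto simp: algebra_simps)
qed

lemma pcong_add:
  assumes "pcong m x y" "pcong m x' y'" shows "pcong m (x + x') (y + y')"
proof -
  obtain z where "y \<in> Zp" "z \<in> Zp" "x = y + of_nat p ^ m * z"
    using pcongE[OF assms(1)] .
  moreover obtain z' where "y' \<in> Zp" "z' \<in> Zp" "x' = y' + of_nat p ^ m * z'"
    using pcongE[OF assms(2)] .
  ultimately show ?thesis by (intro pcongI[of _ "z + z'"]) (auto simp: algebra_simps)
qed

lemma pcong_mult: assumes "pcong m x y" "pcong m x' y'" shows "pcong m (x * x') (y * y')"
proof -
  obtain z where z: "x \<in> Zp" "y \<in> Zp" "z \<in> Zp" "x = y + of_nat p ^ m * z"
    using pcongE[OF assms(1)] .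
  obtain z' where z': "x' \<in> Zp" "y' \<in> Zp" "z' \<in> Zp" "x' = y' + of_nat p ^ m * z'"
    using pcongE[OF assms(2)] .
  have "x * x' = y * y' + of_nat p ^ m * (z * x' + y * z')"
    by (simp add: z z' algebra_simps)
  then show ?thesis using z z' by (intro pcongI[of _ "z * x' + y * z'"]) auto
qed

lemma pcong_sum: "(\<And>i. i \<in> A \<Longrightarrow> pcong m (f i) (g i)) \<Longrightarrow> pcong m (sum f A) (sum g A)"
  by (induction A rule: infinite_finite_induct) (auto intro: pcong_add)

lemma pcong_prod: "(\<And>i. i \<in> A \<Longrightarrow> pcong m (f i) (g i)) \<Longrightarrow> pcong m (prod f A) (prod g A)"
  by (induction A rule: infinite_finite_induct) (auto intro: pcong_mult)

lemma pcong_power: "pcong m x y \<Longrightarrow> pcong m (x ^ k) (y ^ k)"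
  by (induction k) (auto intro: pcong_mult)

text \<open>Write \<open>v = u * (1 + p * (z / u))\<close> with \<open>z / u = a / b\<close>
  integral. The second factor is \<open>(b + p * a) / b\<close>, whose numerator is again prime to
  \<open>p\<close>.\<close>

lemma punit_pcong:
  assumes "punit u" "pcong 1 v u"
  shows "punit v"
proof -
  obtain z where z: "z \<in> Zp" "v = u + of_nat p ^ 1 * z" using pcongE[OF assms(2)] .
  have "z / u \<in> Zp" using z assms(1) by auto
  then obtain a b where ab: "\<not> int p dvd b" "z / u = of_int a / of_int b"
    unfolding Zp_iff by blast
  have b: "b \<noteq> 0" using ab by auto
  have u: "u \<noteq> 0" using assms(1) by (rule punit_nonzero)
  have "v = u * (1 + of_nat p * (z / u))" using z u by (simp add: distrib_left)
  also have "1 + of_nat p * (z / u) = of_int (b + int p * a) / of_int b"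
    using b unfolding ab by (simp add: field_simps)
  finally have v: "v = u * (of_int (b + int p * a) / of_int b)" .
  have "\<not> int p dvd b + int p * a" using ab by (simp add: dvd_add_left_iff)
  then show ?thesis unfolding v using ab assms(1) by (intro punit_mult punit_quotient)
qed

text \<open>Over the common denominator \<open>u * v\<close> the claim becomes \<open>x * v\<close>
  against \<open>y * u\<close>. The unit property of \<open>u\<close> is inherited from
  \<open>v\<close>.\<close>

lemma pcong_divide:
  assumes "pcong 1 x y" "pcong 1 u v" "punit v"
  shows "pcong 1 (x / u) (y / v)"
proof -
  have u: "punit u" using assms punit_pcong by blast
  note nz = punit_nonzero[OF u] punit_nonzero[OF assms(3)]
  have "pcong 1 (x * v * (1 / (u * v))) (y * u * (1 / (u * v)))"
    using assms u by (intro pcong_mult pcong_refl pcong_sym[OF assms(2)]) (auto intro: pcong_sym)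
  then show ?thesis using nz by simp
qed

text \<open>Explicit powers of \<open>p\<close> raise the modulus: congruences modulo
  \<open>p^4\<close> come from ones modulo \<open>p\<close> with a factor \<open>p^3\<close>, or
  modulo \<open>p^3\<close> with a factor \<open>p\<close>.\<close>

lemma pcong_scale:
  assumes "pcong m x y" shows "pcong (k + m) (of_nat p ^ k * x) (of_nat p ^ k * y)"
proof -
  obtain z where "y \<in> Zp" "z \<in> Zp" "x = y + of_nat p ^ m * z"
    using pcongE[OF assms] .
  then show ?thesis by (intro pcongI[of _ z]) (auto simp: algebra_simps power_add intro!: Zp_mult Zp_power)
qed

lemma padic_congI: "pcong m x y \<Longrightarrow> padic_cong p m x y"
  by (simp add: pcong_def)

end

section \<open>Euler polynomials\<close>

lemma euler_gf_mult: "euler_gf x * (fps_exp 1 + 1) = 2 * fps_exp x"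
proof -
  have "Abs_fps (\<lambda>n. euler_poly n x / fact n) = euler_gf x"
    by (simp add: euler_poly_def fps_eq_iff)
  then show ?thesis using euler_poly_gf[of x] by simp
qed

lemma fps_exp_plus_1_nonzero: "fps_exp 1 + 1 \<noteq> (0 :: 'a::field_char_0 fps)"
proof
  assume "fps_exp 1 + 1 = (0 :: 'a fps)"
  then have "fps_nth (fps_exp 1 + 1 :: 'a fps) 0 = 0" by simp
  then show False by simp
qed

lemma euler_gf_add: "euler_gf (x + y) = euler_gf x * fps_exp y"
proof -
  have "euler_gf (x + y) * (fps_exp 1 + 1) = (euler_gf x * fps_exp y) * (fps_exp 1 + 1)"
    using euler_gf_mult[of x] euler_gf_mult[of "x + y"]
    by (simp add: fps_exp_add_mult mult_ac)
  then show ?thesis by (simp add: fps_exp_plus_1_nonzero)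
qed

text \<open>The Appell property. At \<open>x = 0\<close> it expands the Euler polynomial in powers
  of \<open>y\<close> with coefficients \<open>(m choose k) * euler_poly k 0\<close>.\<close>

lemma euler_poly_add:
  "euler_poly m (x + y) = (\<Sum>k\<le>m. of_nat (m choose k) * euler_poly k x * y ^ (m - k))"
  unfolding euler_poly_def euler_gf_add fps_mult_nth sum_distrib_left
  by (intro sum.cong) (auto simp: atLeast0AtMost binomial_fact)

lemma euler_poly_plus_1: "euler_poly m (x + 1) + euler_poly m x = 2 * x ^ m"
proof -
  have "euler_gf (x + 1) + euler_gf x = 2 * fps_exp x"
    using euler_gf_mult[of x] unfolding euler_gf_add[of x 1] by (simp add: distrib_left)
  then have "fps_nth (euler_gf (x + 1) + euler_gf x) m = fps_nth (fps_const 2 * fps_exp x) m"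
    by (simp only: numeral_fps_const)
  then have "fps_nth (euler_gf (x + 1)) m + fps_nth (euler_gf x) m = 2 * (x ^ m / fact m)"
    by simp
  then have "fact m * (fps_nth (euler_gf (x + 1)) m + fps_nth (euler_gf x) m)
      = fact m * (2 * (x ^ m / fact m))" by (simp only:)
  then show ?thesis unfolding euler_poly_def by (simp only: distrib_left) simp
qed

text \<open>For \<open>G(t) = 2 / (e^t + 1)\<close> one has \<open>G(t) + G(-t) = 2\<close>, so the
  even coefficients of positive index vanish. \<open>H\<close> is \<open>G(-t)\<close>.\<close>

lemma euler_poly_0_even:
  assumes "even m" "m > 0"
  shows "euler_poly m (0 :: 'a::field_char_0) = 0"
proof -
  let ?G = "euler_gf (0 :: 'a)" and ?X = "fps_const (- 1 :: 'a) * fps_X"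
  define H where "H = ?G oo ?X"
  have "(?G * (fps_exp 1 + 1)) oo ?X = fps_const 2 oo ?X"
    using euler_gf_mult[of "0 :: 'a"] by (simp add: numeral_fps_const)
  then have "H * (fps_exp (- 1) + 1) = 2"
    by (simp add: H_def fps_compose_mult_distrib fps_compose_add_distrib fps_exp_compose_linear
        numeral_fps_const del: fps_const_neg)
  moreover have "fps_exp 1 * fps_exp (- 1 :: 'a) = 1"
    using fps_exp_add_mult[of 1 "- 1 :: 'a"] by simp
  ultimately have "H * (fps_exp 1 + 1) = 2 * fps_exp 1"
    by (metis (no_types, lifting) add.commute distrib_left mult.assoc mult.commute mult.right_neutral)
  then have "(H + ?G) * (fps_exp 1 + 1) = 2 * (fps_exp 1 + 1)"
    using euler_gf_mult[of "0 :: 'a"] by (simp add: algebra_simps)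
  then have "H + ?G = 2" using fps_exp_plus_1_nonzero mult_right_cancel by blast
  then have "fps_nth (H + ?G) m = fps_nth 2 m" by simp
  moreover have "fps_nth H m = fps_nth ?G m"
    unfolding H_def fps_compose_linear using assms by simp
  ultimately have "2 * fps_nth ?G m = 0"
    using assms by (simp add: numeral_fps_const)
  then show ?thesis by (simp add: euler_poly_def)
qed

section \<open>Euler polynomials and powers modulo \<open>p\<close>\<close>

context prime_localization
begin

text \<open>Combining \<open>euler_poly_plus_1\<close> with the expansion of
  \<open>euler_poly k (0 + 1)\<close> gives a recursion whose only division is by 2, a unit for odd
  \<open>p\<close>.\<close>

lemma euler_poly_0_Zp:
  assumes "p > 2"
  shows "euler_poly k 0 \<in> Zp"
proof (induction k rule: less_induct)
  case (less k)
  have "2 * euler_poly k (0 :: rat) + (\<Sum>i<k. of_nat (k choose i) * euler_poly i 0) = 2 * 0 ^ k"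
    using euler_poly_plus_1[of k "0 :: rat"] euler_poly_add[of k "0 :: rat" 1]
    by (simp add: lessThan_Suc_atMost[symmetric])
  then have "euler_poly k (0 :: rat) = (2 * 0 ^ k - (\<Sum>i<k. of_nat (k choose i) * euler_poly i 0)) / of_nat 2"
    by (simp add: algebra_simps)
  also have "\<dots> \<in> Zp"
    using less assms by (intro Zp_divide_punit Zp_diff Zp_mult Zp_sum punit_of_nat) (auto simp: power_0_left)
  finally show ?case .
qed

lemma pcong_euler_poly:
  assumes "p > 2" "pcong m x y"
  shows "pcong m (euler_poly k x) (euler_poly k y)"
  unfolding euler_poly_add[of k 0 x, simplified] euler_poly_add[of k 0 y, simplified] using assms
  by (intro pcong_sum pcong_mult pcong_power pcong_refl euler_poly_0_Zp Zp_of_nat)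

lemma pcong_of_nat:
  assumes "[a = b] (mod p)"
  shows "pcong 1 (of_nat a) (of_nat b)"
proof -
  have "int p dvd int a - int b"
    using assms by (simp add: cong_int_iff[symmetric] cong_iff_dvd_diff)
  then obtain c where "int a - int b = int p * c" by (elim dvdE)
  then have "int a = int b + int p * c" by (simp only: diff_eq_eq add.commute)
  then have "of_int (int a) = (of_int (int b + int p * c) :: rat)" by (simp only:)
  then have "of_nat a = (of_nat b + of_nat p ^ 1 * of_int c :: rat)"
    by (simp only: of_int_add of_int_mult of_int_of_nat_eq power_one_right)
  then show ?thesis by (rule pcongI[OF Zp_of_nat Zp_of_int])
qed

text \<open>Fermat's little theorem \<open>i^(p-1) \<equiv> 1\<close>, divided by the unit
  \<open>i^k\<close>.\<close>

lemma pcong_inverse_power: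
  assumes "0 < i" "i < p" "k \<le> p - 1"
  shows "pcong 1 (1 / of_nat i ^ k) (of_nat i ^ (p - 1 - k))"
proof -
  have "\<not> p dvd i" using assms by (simp add: nat_dvd_not_less)
  from pcong_of_nat[OF fermat_theorem[OF prime_p this]]
  have "pcong 1 (of_nat i ^ (p - 1)) 1" by simp
  moreover have u: "punit (of_nat i ^ k)" using assms by (intro punit_power punit_of_nat)
  ultimately have "pcong 1 (of_nat i ^ (p - 1) / of_nat i ^ k) (1 / of_nat i ^ k)"
    using pcong_divide pcong_refl punit_Zp by blast
  moreover have "of_nat i ^ (p - 1) / of_nat i ^ k = (of_nat i ^ (p - 1 - k) :: rat)"
    using assms by (subst power_diff) auto
  ultimately show ?thesis using pcong_sym by simp
qed

end

lemma alternating_sum_telescope: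
  fixes f :: "nat \<Rightarrow> 'a::comm_ring_1"
  shows "(\<Sum>j<n. (- 1) ^ j * (f j + f (Suc j))) = f 0 - (- 1) ^ n * f n"
  by (induction n) (simp_all add: algebra_simps)

section \<open>The sum up to $(p-1)/3$\<close>

locale prime_1_mod_3 = prime_localization +
  fixes n :: nat
  assumes p_eq: "p = 3 * n + 1"
begin

lemma p_odd: "odd p"
proof -
  have "p \<noteq> 2" using p_eq by presburger
  then show ?thesis using prime_p prime_odd_nat prime_ge_2_nat[OF prime_p] by fastforce
qed

lemma n_even: "even n" and n_less: "2 * n < p" "n < p" and p_gt: "p > 3"
proof -
  have "p \<ge> 2" using prime_p by (rule prime_ge_2_nat)
  then have "0 < n" using p_eq by auto
  show "even n" using p_odd p_eq by auto
  with \<open>0 < n\<close> have "n \<ge> 2" by (cases "n = 1") auto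
  then show "2 * n < p" "n < p" "p > 3" using p_eq by auto
qed

lemma punit_3: "punit 3" and punit_2: "punit 2"
  using punit_of_nat[of 3] punit_of_nat[of 2] p_gt by simp_all

text \<open>The last interpolation node \<open>1/3 + n\<close>. It is \<open>p\<close> times a unit,
  whence \<open>1/3 \<equiv> - n\<close> modulo \<open>p\<close>.\<close>

definition h :: rat where "h = of_nat p / 3"

lemma h_eq: "h = of_nat n + 1 / 3"
  unfolding h_def by (simp add: p_eq add_divide_distrib)

lemma h_nonzero: "h \<noteq> 0"
  unfolding h_def by (simp add: p_eq del: of_nat_mult of_nat_add)

section \<open>Pochhammer symbols at 1/3 modulo \<open>p\<close>\<close>

lemma pcong_add_h:
  assumes "y \<in> Zp" "z \<in> Zp"
  shows "pcong 1 (y + z * h) y"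
proof (rule pcongI)
  show "z / 3 \<in> Zp" using assms punit_3 by auto
  show "y + z * h = y + of_nat p ^ 1 * (z / 3)" by (simp add: h_def)
qed fact

lemma pcong_third_plus: "pcong 1 (1 / 3 + of_nat i) (of_nat i - of_nat n)"
  using pcong_add_h[OF Zp_diff[OF Zp_of_nat Zp_of_nat] Zp_1, of i n] by (simp add: h_eq add_ac)

text \<open>The factor with index \<open>n\<close> is \<open>h\<close>; every other factor
  \<open>1/3 + i\<close> is congruent to \<open>i - n\<close>.\<close>

lemma pochhammer_third:
  assumes "n < k"
  obtains B where "pochhammer (1 / 3) k = h * B"
    and "pcong 1 B ((- 1) ^ n * fact n * fact (k - 1 - n))"
proof
  let ?B = "\<Prod>i\<in>{..<k}-{n}. 1 / 3 + of_nat i :: rat"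
  show "pochhammer (1 / 3) k = h * ?B"
    using assms by (simp add: pochhammer_lessThan prod.remove[of _ n] h_eq add_ac)
  have "pcong 1 ?B (\<Prod>i\<in>{..<k}-{n}. of_nat i - of_nat n)"
    by (intro pcong_prod pcong_third_plus)
  moreover have "{..<k} = {..k - 1}" using assms by auto
  ultimately show "pcong 1 ?B ((- 1) ^ n * fact n * fact (k - 1 - n))"
    using assms prod_of_nat_diff_remove[of n "k - 1", where 'a = rat] by simp
qed

text \<open>The factor \<open>i + 1/3 + j\<close> equals \<open>h\<close> exactly for
  \<open>i = n - j\<close>; the others are congruent to \<open>i - (n - j)\<close>.\<close>

lemma pochhammer_four_thirds:
  assumes j: "j < n"
  obtains B where "pochhammer (1 + 1 / 3 + of_nat j) n = h * B"
    and "pcong 1 B ((- 1) ^ j * fact j * fact (n - j) / - of_nat (n - j))"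
proof
  let ?I = "{1..n} - {n - j}"
  let ?B = "\<Prod>i\<in>?I. 1 / 3 + of_nat (i + j) :: rat"
  have *: "n - j \<in> {1..n}" using j by auto
  have "pochhammer (1 + (1 / 3 + of_nat j)) n = (\<Prod>i\<in>{1..n}. of_nat i + (1 / 3 + of_nat j) :: rat)"
    by (rule pochhammer_Suc_shift)
  also have "\<dots> = (of_nat (n - j) + (1 / 3 + of_nat j)) * (\<Prod>i\<in>?I. of_nat i + (1 / 3 + of_nat j))"
    by (rule prod.remove[OF _ *]) simp
  also have "of_nat (n - j) + (1 / 3 + of_nat j) = h"
    using j by (simp add: h_eq of_nat_diff)
  finally show "pochhammer (1 + 1 / 3 + of_nat j) n = h * ?B" by (simp add: add_ac)
  have "pcong 1 ?B (\<Prod>i\<in>?I. of_nat (i + j) - of_nat n)"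
    by (intro pcong_prod pcong_third_plus)
  also have "(\<Prod>i\<in>?I. of_nat (i + j) - of_nat n) = (\<Prod>i\<in>?I. of_nat i - of_nat (n - j) :: rat)"
    using j by (intro prod.cong) (auto simp: of_nat_diff)
  also have "\<dots> = (- 1) ^ j * fact j * fact (n - j) / - of_nat (n - j)"
  proof -
    \<comment> \<open>\<open>prod_of_nat_diff_remove\<close> also includes the index 0, whose factor
      \<open>- (n - j)\<close> must be divided out again.\<close>
    have "{..n} - {n - j} = insert 0 ?I" using j by auto
    then have "- of_nat (n - j) * (\<Prod>i\<in>?I. of_nat i - of_nat (n - j) :: rat)
        = (\<Prod>i\<in>{..n} - {n - j}. of_nat i - of_nat (n - j))"
      by simp
    also have "\<dots> = (- 1) ^ (n - j) * fact (n - j) * fact j"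
      using prod_of_nat_diff_remove[of "n - j" n, where 'a = rat] j by simp
    also have "(- 1) ^ (n - j) = ((- 1) ^ j :: rat)"
      using j n_even by (auto simp: minus_one_power_iff)
    finally have "- of_nat (n - j) * (\<Prod>i\<in>?I. of_nat i - of_nat (n - j) :: rat)
        = (- 1) ^ j * fact j * fact (n - j)" by (simp only: mult_ac)
    then show ?thesis using j by (simp add: field_simps)
  qed
  finally show "pcong 1 ?B ((- 1) ^ j * fact j * fact (n - j) / - of_nat (n - j))" .
qed

section \<open>Terms of the expansion at \<open>a = 1/3\<close>\<close>

definition expansion_term :: "nat \<Rightarrow> rat" where
  "expansion_term j = 2 * pochhammer (1 / 3) (Suc n) ^ 2 * pochhammer (1 + 1 / 3 + of_nat j) n
        * pochhammer (1 - 1 / 3 - of_nat j) n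
        / (fact n ^ 2 * fact j * fact (n - j) * pochhammer (2 * (1 / 3) + of_nat j) (Suc n))"

text \<open>Three factors \<open>h\<close> appear: two from the squared symbol and one from
  \<open>pochhammer_four_thirds\<close>. The denominator is a unit, and modulo \<open>p\<close> the
  products \<open>C\<close> and \<open>D\<close> share the factor \<open>C'\<close>, which
  cancels.\<close>

lemma expansion_term_less:
  assumes j: "j < n"
  obtains z where "3 * expansion_term j = of_nat p ^ 3 * z"
    and "pcong 1 z (2 / 9 * ((- 1) ^ j / of_nat (n - j) ^ 2))"
proof -
  obtain A where A: "pochhammer (1 / 3) (Suc n) = h * A" "pcong 1 A ((- 1) ^ n * fact n * fact (Suc n - 1 - n))"
    using pochhammer_third[of "Suc n"] by auto
  obtain B where B: "pochhammer (1 + 1 / 3 + of_nat j) n = h * B"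
    "pcong 1 B ((- 1) ^ j * fact j * fact (n - j) / - of_nat (n - j))"
    using pochhammer_four_thirds[OF j] .
  define C where "C = pochhammer (1 - 1 / 3 - of_nat j :: rat) n"
  define D where "D = pochhammer (2 * (1 / 3) + of_nat j :: rat) (Suc n)"
  \<comment> \<open>All factors \<open>i + (n - j)\<close> lie between 1 and
    \<open>2 * n < p\<close>, so \<open>C'\<close> is a unit.\<close>
  define C' where "C' = (\<Prod>i\<in>{1..n}. of_nat (i + (n - j)) :: rat)"
  have A1: "pcong 1 A (fact n)" using A(2) n_even by simp
  have C: "pcong 1 C C'"
  proof -
    have "C = (\<Prod>i\<in>{1..n}. of_nat (i + (n - j)) + (- 1) * h)"
      unfolding C_def using pochhammer_Suc_shift[of "- 1 / 3 - of_nat j :: rat" n] j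
      by (simp add: h_eq of_nat_diff algebra_simps)
    also have "pcong 1 \<dots> C'"
      unfolding C'_def by (intro pcong_prod pcong_add_h Zp_of_nat Zp_minus Zp_1)
    finally show ?thesis .
  qed
  have C'u: "punit C'"
    unfolding C'_def using j p_eq by (intro punit_prod punit_of_nat) auto
  have nj: "punit (of_nat (n - j))" using j n_less by (intro punit_of_nat) auto
  have D: "pcong 1 D (- (of_nat (n - j) * C'))"
  proof -
    \<comment> \<open>Here \<open>2/3 + j + i = 2 * h - (2 * n - j - i)\<close>. Reversed, these are
      the negated factors of \<open>C'\<close> together with one more, \<open>n - j\<close>; their
      number \<open>n + 1\<close> is odd.\<close>
    have "D = (\<Prod>i\<le>n. - of_nat (n - j + (n - i)) + 2 * h)"
      unfolding D_def pochhammer_lessThan lessThan_Suc_atMost using j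
      by (intro prod.cong) (auto simp: h_eq of_nat_diff)
    also have "pcong 1 \<dots> (\<Prod>i\<le>n. - of_nat (n - j + (n - i)))"
      by (intro pcong_prod pcong_add_h Zp_minus Zp_of_nat Zp_numeral)
    also have "(\<Prod>i\<le>n. - of_nat (n - j + (n - i))) = (\<Prod>i\<le>n. - of_nat (n - j + i) :: rat)"
      by (rule prod.reindex_bij_witness[of _ "\<lambda>i. n - i" "\<lambda>i. n - i"]) auto
    also have "\<dots> = (\<Prod>i\<le>n. - 1) * (\<Prod>i\<le>n. of_nat (n - j + i))"
      by (subst prod.distrib[symmetric]) simp
    also have "{..n} = insert 0 {1..n}" by auto
    then have "(\<Prod>i\<le>n. of_nat (n - j + i)) = (of_nat (n - j) * C' :: rat)"
      by (simp add: C'_def add.commute)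
    also have "(\<Prod>i\<le>n. - 1) = (- 1 :: rat)" using n_even by simp
    finally show ?thesis by simp
  qed
  have fu: "punit (fact n ^ 2 * fact j * fact (n - j))"
    using j n_less by (intro punit_mult punit_power punit_fact) auto
  define q where "q = A ^ 2 * B * C / (fact n ^ 2 * fact j * fact (n - j) * D)"
  have "pcong 1 q (fact n ^ 2 * ((- 1) ^ j * fact j * fact (n - j) / - of_nat (n - j)) * C'
      / (fact n ^ 2 * fact j * fact (n - j) * - (of_nat (n - j) * C')))"
    unfolding q_def
    by (intro pcong_divide pcong_mult pcong_power A1 B(2) C D pcong_refl punit_Zp[OF fu, THEN pcong_refl]
        punit_mult[OF fu] punit_minus punit_mult[OF nj C'u])
  also have "fact n ^ 2 * ((- 1) ^ j * fact j * fact (n - j) / - of_nat (n - j)) * C'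
      / (fact n ^ 2 * fact j * fact (n - j) * - (of_nat (n - j) * C'))
      = (- 1) ^ j / (of_nat (n - j) ^ 2 :: rat)"
  proof -
    have "f ^ 2 * (s * g * k / - N) * c / (f ^ 2 * g * k * - (N * c)) = s / N ^ 2"
      if "f \<noteq> 0" "g \<noteq> 0" "k \<noteq> 0" "N \<noteq> 0" "c \<noteq> 0" for f g k s N c :: rat
      using that by (simp add: power2_eq_square)
    from this[OF fact_nonzero fact_nonzero fact_nonzero punit_nonzero[OF nj] punit_nonzero[OF C'u]]
    show ?thesis .
  qed
  finally have q: "pcong 1 q ((- 1) ^ j / of_nat (n - j) ^ 2)" .
  \<comment> \<open>The constant is \<open>3 * 2 / 27\<close>, with \<open>27\<close> from the three
    factors \<open>h = p / 3\<close>.\<close>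
  have "3 * expansion_term j = of_nat p ^ 3 * (2 / 9 * q)"
    unfolding expansion_term_def A(1) B(1) C_def[symmetric] D_def[symmetric] q_def
    by (simp add: h_def power2_eq_square power3_eq_cube mult_ac)
  moreover have "pcong 1 (2 / 9 * q) (2 / 9 * ((- 1) ^ j / of_nat (n - j) ^ 2))"
  proof -
    have "punit (3 * 3)" by (intro punit_mult punit_3)
    then have "2 / 9 \<in> Zp" using Zp_divide_punit[of 2 9] by simp
    then show ?thesis using q by (intro pcong_mult pcong_refl)
  qed
  ultimately show ?thesis using that by blast
qed

text \<open>All factors can be written through \<open>h\<close> and
  \<open>1 \<le> i \<le> n\<close>, so the term is \<open>p\<close> times a product of ratios
  \<open>r i\<close>, each congruent to 1 modulo \<open>p^3\<close>.\<close>

lemma expansion_term_n: "pcong 4 (3 * expansion_term n) (of_nat p)"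
proof -
  define r where "r i = (h - of_nat i) ^ 2 * (of_nat i + h) * (of_nat i - h)
      / (of_nat i ^ 3 * (of_nat i - 2 * h))" for i :: nat
  have 1: "pochhammer (1 / 3) (Suc n) = h * (\<Prod>i\<in>{1..n}. h - of_nat i)"
  proof -
    have "(\<Prod>i<n. 1 / 3 + of_nat i) = (\<Prod>i\<in>{1..n}. h - of_nat i)"
      by (rule prod.reindex_bij_witness[of _ "\<lambda>i. n - i" "\<lambda>i. n - i"])
        (auto simp: h_eq of_nat_diff)
    then show ?thesis by (simp add: pochhammer_Suc pochhammer_lessThan h_eq add_ac)
  qed
  have 2: "pochhammer (1 + 1 / 3 + of_nat n) n = (\<Prod>i\<in>{1..n}. of_nat i + h)"
    using pochhammer_Suc_shift[of h n] by (simp add: h_eq add_ac)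
  have 3: "pochhammer (1 - 1 / 3 - of_nat n) n = (\<Prod>i\<in>{1..n}. of_nat i - h)"
    using pochhammer_Suc_shift[of "- h" n] by (simp add: h_eq algebra_simps)
  have 4: "pochhammer (2 * (1 / 3) + of_nat n) (Suc n) = 2 * h * (\<Prod>i\<in>{1..n}. of_nat i - 2 * h)"
  proof -
    have "pochhammer (2 * (1 / 3) + of_nat n) (Suc n) = (\<Prod>i\<le>n. 2 * h - of_nat i)"
      unfolding pochhammer_lessThan lessThan_Suc_atMost
      by (rule prod.reindex_bij_witness[of _ "\<lambda>i. n - i" "\<lambda>i. n - i"])
        (auto simp: h_eq of_nat_diff)
    also have "{..n} = insert 0 {1..n}" by auto
    then have "(\<Prod>i\<le>n. 2 * h - of_nat i) = 2 * h * (\<Prod>i\<in>{1..n}. - 1 * (of_nat i - 2 * h))"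
      by simp
    also have "\<dots> = 2 * h * (\<Prod>i\<in>{1..n}. of_nat i - 2 * h)"
      using n_even by (subst prod.distrib) simp
    finally show ?thesis .
  qed
  have 5: "(fact n :: rat) = (\<Prod>i\<in>{1..n}. of_nat i)"
    by (simp add: fact_prod)
  \<comment> \<open>The isolated powers of \<open>h\<close> combine to
    \<open>3 * 2 * h^2 / (2 * h) = p\<close>.\<close>
  have "3 * expansion_term n = of_nat p * (\<Prod>i\<in>{1..n}. r i)"
    unfolding expansion_term_def 1 2 3 4 r_def prod_dividef prod.distrib prod_power_distrib[symmetric]
    using h_nonzero by (simp add: 5 h_def power2_eq_square power3_eq_cube mult_ac)
  moreover have "pcong 3 (\<Prod>i\<in>{1..n}. r i) (\<Prod>i\<in>{1..n}. 1)"
  proof (rule pcong_prod)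
    fix i assume i: "i \<in> {1..n}"
    let ?i = "of_nat i :: rat"
    have u: "punit ?i" using i n_less by (intro punit_of_nat) auto
    have "pcong 1 (?i + (- 2) * h) ?i" by (rule pcong_add_h) (auto intro: Zp_minus)
    then have v: "punit (?i - 2 * h)" using punit_pcong[OF u] by simp
    define d where "d = ?i ^ 3 * (?i - 2 * h)"
    have d: "punit d" unfolding d_def by (intro punit_mult punit_power u v)
    \<comment> \<open>The left side is \<open>(i - h)^3 * (i + h)\<close>, whose \<open>h^2\<close>
      terms cancel; the part up to first order in \<open>h\<close> is exactly the denominator
      \<open>d\<close>.\<close>
    have "(h - ?i) ^ 2 * (?i + h) * (?i - h) = d + h ^ 3 * (2 * ?i - h)"
      unfolding d_def by (simp add: power2_eq_square power3_eq_cube algebra_simps)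
    then have "r i = (d + h ^ 3 * (2 * ?i - h)) / d"
      unfolding r_def d_def by (simp only:)
    also have "\<dots> = 1 + of_nat p ^ 3 * ((2 * ?i - h) / (3 ^ 3 * d))"
      using punit_nonzero[OF d] by (simp add: add_divide_distrib h_def power_divide)
    finally have "r i = 1 + of_nat p ^ 3 * ((2 * ?i - h) / (3 ^ 3 * d))" .
    moreover have "h \<in> Zp" unfolding h_def using punit_3 by auto
    then have "(2 * ?i - h) / (3 ^ 3 * d) \<in> Zp"
      by (intro Zp_divide_punit Zp_diff Zp_mult punit_mult punit_power punit_3 d) auto
    ultimately show "pcong 3 (r i) 1" using pcongI[OF Zp_1] by blast
  qed
  from pcong_scale[OF this, of 1] have "pcong 4 (of_nat p * (\<Prod>i\<in>{1..n}. r i)) (of_nat p)"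
    by simp
  ultimately show ?thesis by simp
qed

text \<open>The inverse square of \<open>n - j\<close> becomes \<open>(j - n)^(p-3)\<close>, as
  \<open>p - 3\<close> is even, and twice this power is a sum of two neighbouring Euler values. The
  alternating sum then telescopes.\<close>

lemma alternating_square_sum:
  "pcong 1 (\<Sum>j<n. 2 * ((- 1) ^ j / of_nat (n - j) ^ 2)) (euler_poly (p - 3) (1 / 3))"
proof -
  let ?E = "euler_poly (p - 3) :: rat \<Rightarrow> rat"
  have ev: "even (p - 3)" "p - 3 > 0" using p_odd p_gt by auto
  have "pcong 1 (\<Sum>j<n. 2 * ((- 1) ^ j / of_nat (n - j) ^ 2))
      (\<Sum>j<n. (- 1) ^ j * (?E (of_nat j - of_nat n) + ?E (of_nat (Suc j) - of_nat n)))"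
  proof (rule pcong_sum)
    fix j assume "j \<in> {..<n}"
    then have j: "j < n" by simp
    have "pcong 1 (1 / of_nat (n - j) ^ 2) (of_nat (n - j) ^ (p - 1 - 2))"
      using j n_less p_gt by (intro pcong_inverse_power) auto
    moreover have "p - 1 - 2 = p - 3" by simp
    ultimately have "pcong 1 (1 / of_nat (n - j) ^ 2) (of_nat (n - j) ^ (p - 3))" by (simp only:)
    then have "pcong 1 ((- 1) ^ j * 2 * (1 / of_nat (n - j) ^ 2)) ((- 1) ^ j * 2 * of_nat (n - j) ^ (p - 3))"
      by (intro pcong_mult pcong_refl Zp_mult Zp_power Zp_minus Zp_1 Zp_numeral)
    also have "of_nat (n - j) ^ (p - 3) = (of_nat j - of_nat n :: rat) ^ (p - 3)"
      using j power_minus_even[OF ev(1), of "of_nat j - of_nat n :: rat"] by (simp add: of_nat_diff)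
    also have "(- 1) ^ j * 2 * (of_nat j - of_nat n) ^ (p - 3)
        = (- 1) ^ j * (?E (of_nat j - of_nat n + 1) + ?E (of_nat j - of_nat n))"
      by (simp only: euler_poly_plus_1 mult.assoc)
    finally show "pcong 1 (2 * ((- 1) ^ j / of_nat (n - j) ^ 2))
      ((- 1) ^ j * (?E (of_nat j - of_nat n) + ?E (of_nat (Suc j) - of_nat n)))"
      by (simp add: add_ac mult_ac diff_add_eq add_diff_eq)
  qed
  \<comment> \<open>The other end of the telescope is \<open>?E 0\<close>, which vanishes by
    parity.\<close>
  also have "\<dots> = ?E (- of_nat n)"
    unfolding alternating_sum_telescope[of "\<lambda>j. ?E (of_nat j - of_nat n)"]
    by (simp add: euler_poly_0_even[OF ev])
  also have "pcong 1 \<dots> (?E (1 / 3))"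
  proof (rule pcong_euler_poly)
    show "pcong 1 (- of_nat n) (1 / 3)"
      using pcong_sym[OF pcong_third_plus[of 0]] by simp
  qed (use p_gt in simp)
  finally show ?thesis .
qed

definition summand :: "nat \<Rightarrow> rat" where
  "summand k = (- 1) ^ k * (6 * of_nat k + 1) * pochhammer (1 / 3) k ^ 3 / fact k ^ 3"

lemma sum_upto_n:
  "pcong 4 (\<Sum>k\<le>n. summand k) (of_nat p + of_nat p ^ 3 / 9 * euler_poly (p - 3) (1 / 3))"
proof -
  have nonint: "2 * (1 / 3 :: rat) \<notin> \<int>"
  proof
    assume "2 * (1 / 3 :: rat) \<in> \<int>"
    then obtain z :: int where "2 * (1 / 3 :: rat) = of_int z" by (auto elim: Ints_cases)
    then have "(of_int (3 * z) :: rat) = of_int 2" by simp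
    then have "3 * z = 2" by (simp only: of_int_eq_iff)
    then show False by presburger
  qed
  \<comment> \<open>The factor \<open>6 * k + 1\<close> is \<open>3 * (a + 2 * k)\<close> at
    \<open>a = 1/3\<close>.\<close>
  have "(\<Sum>k\<le>n. summand k)
      = 3 * (\<Sum>k\<le>n. (- 1) ^ k * (1 / 3 + 2 * of_nat k) * pochhammer (1 / 3) k ^ 3 / fact k ^ 3)"
    unfolding sum_distrib_left summand_def
    by (intro sum.cong refl) (simp add: field_simps)
  also have "\<dots> = (\<Sum>j<n. 3 * expansion_term j) + 3 * expansion_term n"
    unfolding well_poised_expansion[OF nonint] expansion_term_def[symmetric]
    by (simp add: lessThan_Suc_atMost[symmetric] sum_distrib_left)
  finally have S: "(\<Sum>k\<le>n. summand k) = (\<Sum>j<n. 3 * expansion_term j) + 3 * expansion_term n" .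
  have "\<forall>j\<in>{..<n}. \<exists>z. 3 * expansion_term j = of_nat p ^ 3 * z
      \<and> pcong 1 z (2 / 9 * ((- 1) ^ j / of_nat (n - j) ^ 2))"
    using expansion_term_less by (metis lessThan_iff)
  then obtain z where z: "\<And>j. j < n \<Longrightarrow> 3 * expansion_term j = of_nat p ^ 3 * z j"
      "\<And>j. j < n \<Longrightarrow> pcong 1 (z j) (2 / 9 * ((- 1) ^ j / of_nat (n - j) ^ 2))"
    by (metis lessThan_iff)
  have "(\<Sum>j<n. 3 * expansion_term j) = of_nat p ^ 3 * (\<Sum>j<n. z j)"
    by (simp add: z(1) sum_distrib_left)
  moreover have "pcong 1 (\<Sum>j<n. z j) (1 / 9 * euler_poly (p - 3) (1 / 3))"
  proof -
    have "pcong 1 (\<Sum>j<n. z j) (\<Sum>j<n. 2 / 9 * ((- 1) ^ j / of_nat (n - j) ^ 2))"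
      by (intro pcong_sum z(2)) simp
    also have "\<dots> = 1 / 9 * (\<Sum>j<n. 2 * ((- 1) ^ j / of_nat (n - j) ^ 2))"
      by (simp add: sum_distrib_left)
    also have "pcong 1 \<dots> (1 / 9 * euler_poly (p - 3) (1 / 3))"
    proof -
      have "punit (3 * 3)" by (intro punit_mult punit_3)
      then have "1 / 9 \<in> Zp" using Zp_divide_punit[of 1 9] by simp
      then show ?thesis by (intro pcong_mult pcong_refl alternating_square_sum)
    qed
    finally show ?thesis .
  qed
  from pcong_scale[OF this, of 3]
  have "pcong 4 (of_nat p ^ 3 * (\<Sum>j<n. z j)) (of_nat p ^ 3 * (1 / 9 * euler_poly (p - 3) (1 / 3)))"
    by simp
  ultimately have "pcong 4 (\<Sum>j<n. 3 * expansion_term j)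
      (of_nat p ^ 3 * (1 / 9 * euler_poly (p - 3) (1 / 3)))" by (simp only:)
  from pcong_add[OF this expansion_term_n] show ?thesis
    unfolding S by (simp add: add.commute)
qed

end

section \<open>The tail of the sum\<close>

text \<open>The remaining factorial is the one in \<open>pochhammer_third\<close>, so it cancels
  from the summands with \<open>k > n\<close>.\<close>

lemma fact_eq_prod_mult_fact:
  assumes "n < k"
  shows "fact k = (\<Prod>i\<le>n. of_nat k - of_nat i) * (fact (k - 1 - n) :: 'a::field_char_0)"
  using assms
proof (induction n)
  case 0
  then show ?case by (simp add: fact_reduce)
next
  case (Suc n)
  then have "(fact (k - 1 - n) :: 'a) = of_nat (k - 1 - n) * fact (k - 1 - Suc n)"
    by (subst fact_reduce) auto
  moreover have "of_nat (k - 1 - n) = (of_nat k - of_nat (Suc n) :: 'a)"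
    using Suc.prems by (simp add: of_nat_diff)
  moreover have "fact k = (\<Prod>i\<le>n. of_nat k - of_nat i) * (fact (k - 1 - n) :: 'a)"
    using Suc by simp
  ultimately show ?case by (simp only: prod.atMost_Suc mult.assoc)
qed

context prime_1_mod_3
begin

text \<open>For \<open>n < k < p\<close> this is the summand divided by \<open>p^3\<close>, taken
  modulo \<open>p\<close> and up to the factor \<open>fact n ^ 3 / 9\<close>, which is independent
  of \<open>k\<close>.\<close>

definition tail_term :: "nat \<Rightarrow> rat" where
  "tail_term k = (- 1) ^ k * (2 * of_nat k - of_nat n) / (\<Prod>i\<le>n. of_nat k - of_nat i) ^ 3"

lemma punit_falling:
  assumes "n < k" "k < p"
  shows "punit (\<Prod>i\<le>n. of_nat k - of_nat i)"
proof (rule punit_prod)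
  fix i assume "i \<in> {..n}"
  then show "punit (of_nat k - of_nat i)"
    using assms punit_of_nat[of "k - i"] by (simp add: of_nat_diff)
qed

lemma tail_term_Zp: "n < k \<Longrightarrow> k < p \<Longrightarrow> tail_term k \<in> Zp"
  unfolding tail_term_def
  by (intro Zp_divide_punit punit_power punit_falling Zp_mult Zp_power Zp_minus Zp_diff Zp_1
      Zp_numeral Zp_of_nat)

text \<open>For \<open>k > n\<close> the symbol \<open>pochhammer (1 / 3) k\<close> contains
  \<open>h\<close>, so its cube supplies \<open>p^3 / 27\<close>, while \<open>fact k\<close> is a
  unit because \<open>k < p\<close>.\<close>

lemma summand_tail:
  assumes k: "n < k" "k < p"
  obtains y where "summand k = of_nat p ^ 3 * y"
    and "pcong 1 y ((1 / 9) * fact n ^ 3 * tail_term k)"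
proof -
  obtain B where B: "pochhammer (1 / 3) k = h * B"
    "pcong 1 B ((- 1) ^ n * fact n * fact (k - 1 - n))"
    using pochhammer_third[OF k(1)] .
  define P where "P = (\<Prod>i\<le>n. of_nat k - of_nat i :: rat)"
  have B': "pcong 1 B (fact n * fact (k - 1 - n))" using B(2) n_even by simp
  \<comment> \<open>The difference of the two sides is \<open>3 * n + 1\<close>, which is
    \<open>p\<close> itself.\<close>
  have kn: "pcong 1 (6 * of_nat k + 1) (3 * (2 * of_nat k - of_nat n))"
  proof (rule pcongI[OF _ Zp_1])
    show "3 * (2 * of_nat k - of_nat n) \<in> Zp" by (intro Zp_mult Zp_diff Zp_numeral Zp_of_nat)
    have "of_nat p = (3 * of_nat n + 1 :: rat)" by (subst p_eq) simp
    then show "6 * of_nat k + 1 = 3 * (2 * of_nat k - of_nat n) + of_nat p ^ 1 * (1 :: rat)" by simp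
  qed
  have u: "punit (fact k)" using k by (intro punit_fact)
  have "punit (3 ^ 3)" by (intro punit_power punit_3)
  then have c: "1 / 27 \<in> Zp" by (simp add: punit_def)
  define y where "y = 1 / 27 * ((- 1) ^ k * (6 * of_nat k + 1) * B ^ 3 / fact k ^ 3)"
  have "pcong 1 y (1 / 27 * ((- 1) ^ k * (3 * (2 * of_nat k - of_nat n))
      * (fact n * fact (k - 1 - n)) ^ 3 / fact k ^ 3))"
    unfolding y_def
    by (intro pcong_mult pcong_divide pcong_power kn B' pcong_refl punit_power u c Zp_power Zp_minus
        Zp_1 punit_Zp[OF u])
  also have "1 / 27 * ((- 1) ^ k * (3 * (2 * of_nat k - of_nat n))
      * (fact n * fact (k - 1 - n)) ^ 3 / fact k ^ 3) = (1 / 9) * fact n ^ 3 * tail_term k"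
  proof -
    have "1 / 27 * (s * (3 * E) * (f * g) ^ 3 / (P * g) ^ 3) = 1 / 9 * f ^ 3 * (s * E / P ^ 3)"
      if "g \<noteq> 0" for s E f g :: rat
      using that by (simp add: power_mult_distrib)
    from this[OF fact_nonzero] show ?thesis
      unfolding fact_eq_prod_mult_fact[OF k(1)] tail_term_def P_def[symmetric] .
  qed
  finally have "pcong 1 y ((1 / 9) * fact n ^ 3 * tail_term k)" .
  moreover have "summand k = of_nat p ^ 3 * y"
    unfolding summand_def B(1) y_def h_def by (simp add: power_mult_distrib power_divide)
  ultimately show ?thesis using that by blast
qed

text \<open>Modulo \<open>p\<close> the map sends \<open>k\<close> to \<open>n - k\<close>. The
  linear factor, the power of -1 (as \<open>n + p\<close> is odd) and the cubed product of
  \<open>n + 1\<close> factors (an odd number) each change sign, leaving one sign in all.\<close>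

lemma tail_term_reflect:
  assumes k: "n < k" "k < p"
  shows "pcong 1 (tail_term (n + p - k)) (- tail_term k)"
proof -
  define P where "P = (\<Prod>i\<le>n. of_nat k - of_nat i :: rat)"
  have e: "of_nat (n + p - k) = (of_nat n - of_nat k + of_nat p :: rat)"
    using k by (simp add: of_nat_diff)
  have Pu: "punit P" unfolding P_def by (rule punit_falling[OF k])
  have 1: "pcong 1 (2 * of_nat (n + p - k) - of_nat n) (- (2 * of_nat k - of_nat n))"
  proof (rule pcongI[OF _ Zp_numeral])
    show "- (2 * of_nat k - of_nat n) \<in> Zp"
      by (intro Zp_minus Zp_mult Zp_diff Zp_numeral Zp_of_nat)
    show "2 * of_nat (n + p - k) - of_nat n
        = - (2 * of_nat k - of_nat n) + of_nat p ^ 1 * (2 :: rat)"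
      by (simp add: e)
  qed
  have 2: "pcong 1 (\<Prod>i\<le>n. of_nat (n + p - k) - of_nat i) (- P)"
  proof -
    have "pcong 1 (\<Prod>i\<le>n. of_nat (n + p - k) - of_nat i) (\<Prod>i\<le>n. - (of_nat k - of_nat (n - i)))"
      by (intro pcong_prod pcongI[of _ 1]) (auto simp: e of_nat_diff intro!: Zp_diff)
    also have "(\<Prod>i\<le>n. - (of_nat k - of_nat (n - i))) = (\<Prod>i\<le>n. - (of_nat k - of_nat i) :: rat)"
      by (rule prod.reindex_bij_witness[of _ "\<lambda>i. n - i" "\<lambda>i. n - i"]) auto
    also have "\<dots> = (\<Prod>i\<le>n. - 1) * P"
      unfolding P_def by (subst prod.distrib[symmetric]) simp
    also have "(\<Prod>i\<le>n. - 1) = (- 1 :: rat)" using n_even by simp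
    finally show ?thesis by simp
  qed
  have 3: "(- 1) ^ (n + p - k) = (- ((- 1) ^ k) :: rat)"
    using k n_even p_odd by (auto simp: minus_one_power_iff)
  have "pcong 1 (tail_term (n + p - k))
      (- ((- 1) ^ k) * (- (2 * of_nat k - of_nat n)) / (- P) ^ 3)"
    unfolding tail_term_def 3
    by (intro pcong_divide pcong_mult[OF _ 1] pcong_power[OF 2] punit_power punit_minus Pu
        pcong_refl Zp_minus Zp_power Zp_1)
  moreover have "- s * (- E) / (- P) ^ 3 = - (s * E / P ^ 3)" for s E :: rat
    by (simp add: power3_eq_cube)
  then have "- ((- 1) ^ k) * (- (2 * of_nat k - of_nat n)) / (- P) ^ 3 = - tail_term k"
    unfolding tail_term_def P_def[symmetric] .
  ultimately show ?thesis by (simp only:)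
qed

lemma sum_tail: "pcong 4 (\<Sum>k\<in>{n<..<p}. summand k) 0"
proof -
  let ?T = "\<Sum>k\<in>{n<..<p}. tail_term k"
  have "?T = (\<Sum>k\<in>{n<..<p}. tail_term (n + p - k))"
    by (rule sum.reindex_bij_witness[of _ "\<lambda>k. n + p - k" "\<lambda>k. n + p - k"]) auto
  also have "pcong 1 \<dots> (\<Sum>k\<in>{n<..<p}. - tail_term k)"
    by (intro pcong_sum tail_term_reflect) auto
  \<comment> \<open>The reflection permutes \<open>{n<..<p}\<close>, so the sum is congruent to its
    negative and vanishes because 2 is a unit.\<close>
  finally have "pcong 1 ?T (- ?T)" by (simp add: sum_negf)
  moreover have T: "?T \<in> Zp" by (intro Zp_sum tail_term_Zp) auto
  ultimately have "pcong 1 (?T + ?T) (?T + - ?T)"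
    by (intro pcong_add pcong_refl)
  from pcong_divide[OF this pcong_refl[OF Zp_numeral] punit_2]
  have "pcong 1 ((?T + ?T) / 2) ((?T + - ?T) / 2)" .
  then have T0: "pcong 1 ?T 0" by simp
  have "\<forall>k\<in>{n<..<p}. \<exists>y. summand k = of_nat p ^ 3 * y
      \<and> pcong 1 y ((1 / 9) * fact n ^ 3 * tail_term k)"
    using summand_tail by (metis greaterThanLessThan_iff)
  then obtain y where y: "\<And>k. k \<in> {n<..<p} \<Longrightarrow> summand k = of_nat p ^ 3 * y k"
      "\<And>k. k \<in> {n<..<p} \<Longrightarrow> pcong 1 (y k) ((1 / 9) * fact n ^ 3 * tail_term k)"
    by metis
  have "pcong 1 (\<Sum>k\<in>{n<..<p}. y k) (\<Sum>k\<in>{n<..<p}. (1 / 9) * fact n ^ 3 * tail_term k)"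
    by (intro pcong_sum y(2))
  also have "\<dots> = (1 / 9) * fact n ^ 3 * ?T"
    by (simp add: sum_distrib_left)
  also have "pcong 1 \<dots> ((1 / 9) * fact n ^ 3 * 0)"
  proof -
    have "punit (3 * 3)" by (intro punit_mult punit_3)
    then have "1 / 9 \<in> Zp" by (simp add: punit_def)
    moreover have "fact n \<in> Zp" using n_less by (intro punit_Zp punit_fact)
    ultimately show ?thesis by (intro pcong_mult pcong_refl Zp_mult Zp_power T0)
  qed
  finally have "pcong 4 (of_nat p ^ 3 * (\<Sum>k\<in>{n<..<p}. y k)) 0"
    using pcong_scale[of 1 "\<Sum>k\<in>{n<..<p}. y k" 0 3] by simp
  then show ?thesis by (simp add: y(1) sum_distrib_left)
qed

end

section \<open>Combination of the sum up to \<open>n\<close> with the tail\<close>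

theorem theorem1p1:
  fixes p M :: nat
  assumes "prime p"
    and "[p = 1] (mod 3)"
    and "M = (p - 1) div 3 \<or> M = p - 1"
  shows "padic_cong p 4
           (\<Sum>k=0..M. (- 1) ^ k * (6 * of_nat k + 1) * pochhammer (1 / 3) k ^ 3 / fact k ^ 3)
           (of_nat p + of_nat p ^ 3 / 9 * euler_poly (p - 3) (1 / 3))"
proof -
  define n where "n = (p - 1) div 3"
  have p: "p = 3 * n + 1"
    using assms(2) prime_gt_0_nat[OF assms(1)] unfolding n_def cong_def by presburger
  interpret prime_1_mod_3 p n
    using assms(1) p by unfold_locales
  have "pcong 4 (\<Sum>k\<le>M. summand k)
      (of_nat p + of_nat p ^ 3 / 9 * euler_poly (p - 3) (1 / 3))"
    using assms(3)
  proof
    assume "M = (p - 1) div 3"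
    then show ?thesis using sum_upto_n by (simp add: n_def)
  next
    assume "M = p - 1"
    then have M: "{..M} = {..n} \<union> {n<..<p}" using n_less by auto
    have "(\<Sum>k\<le>M. summand k) = (\<Sum>k\<le>n. summand k) + (\<Sum>k\<in>{n<..<p}. summand k)"
      unfolding M by (rule sum.union_disjoint) auto
    then show ?thesis using pcong_add[OF sum_upto_n sum_tail] by simp
  qed
  then show ?thesis
    unfolding summand_def atLeast0AtMost by (rule padic_congI)
qed

end
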